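(* Let $1<p,q<\infty$ with $1/p+1/q=1$. The infinite Hilbert matrix $\mathcal{H}_0:=\{1/(m+n)\}_{m,n=1}^\infty$ determines a bounded linear mapping from the sequence space $\ell^p$ to itself, and its operator norm satisfies \[ \|\mathcal{H}_0\|_{p,p}=\lim_{s\to 1/p}\frac{\mathcal{W}(s,(p-1)s,1)}{\zeta(ps)}=\pi\,\csc\!\left(\frac{\pi}{p}\right). \]
   Context: For real $r,s,t$ for which the series converges, the Witten (Tornheim double) zeta function is $\mathcal{W}(r,s,t):=\sum_{n=1}^\infty\sum_{m=1}^\infty \frac{1}{n^r\,m^s\,(n+m)^t}$, and $\zeta(x)=\sum_{n\ge1}n^{-x}$ is the Riemann zeta function (for $x>1$). Here $\|\mathcal{H}_0\|_{p,p}=\sup_{\|x\|_p=1}\|\mathcal{H}_0x\|_p$. *)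

theory Defs
  imports "HOL-Analysis.Analysis"
begin

text \<open>
  Sequences \<open>(x\<^sub>1, x\<^sub>2, \<dots>)\<close> are functions on \<open>nat\<close> with \<open>x n\<close> standing for the entry of index
  \<open>n + 1\<close>; the same shift turns each series over \<open>n \<ge> 1\<close> into one over \<open>nat\<close> with \<open>Suc n\<close> in
  place of \<open>n\<close>. The classes \<open>real_normed_field\<close> and \<open>banach\<close> cover real as well as complex scalars.
\<close>

definition lp_space :: "real \<Rightarrow> (nat \<Rightarrow> 'a::real_normed_field) set" where
  "lp_space p = {x. summable (\<lambda>n. norm (x n) powr p)}"

definition lp_norm :: "real \<Rightarrow> (nat \<Rightarrow> 'a::real_normed_field) \<Rightarrow> real" where
  "lp_norm p x = (\<Sum>n. norm (x n) powr p) powr (1 / p)"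

definition lp_bounded_linear ::
    "real \<Rightarrow> ((nat \<Rightarrow> 'a::real_normed_field) \<Rightarrow> (nat \<Rightarrow> 'a)) \<Rightarrow> bool" where
  "lp_bounded_linear p T \<longleftrightarrow>
     (\<forall>x\<in>lp_space p. T x \<in> lp_space p) \<and>
     (\<forall>x\<in>lp_space p. \<forall>y\<in>lp_space p. T (\<lambda>n. x n + y n) = (\<lambda>m. T x m + T y m)) \<and>
     (\<forall>c. \<forall>x\<in>lp_space p. T (\<lambda>n. c * x n) = (\<lambda>m. c * T x m)) \<and>
     (\<exists>C. \<forall>x\<in>lp_space p. lp_norm p (T x) \<le> C * lp_norm p x)"

text \<open>A supremum in \<open>real\<close>, hence meaningful only for maps satisfying \<open>lp_bounded_linear p\<close>.\<close>

definition lp_opnorm ::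
    "real \<Rightarrow> ((nat \<Rightarrow> 'a::real_normed_field) \<Rightarrow> (nat \<Rightarrow> 'a)) \<Rightarrow> real" where
  "lp_opnorm p T = (SUP x\<in>{x \<in> lp_space p. lp_norm p x = 1}. lp_norm p (T x))"

definition hilbert_matrix :: "nat \<Rightarrow> nat \<Rightarrow> real" where
  "hilbert_matrix m n = 1 / (real (Suc m) + real (Suc n))"

definition matrix_map ::
    "(nat \<Rightarrow> nat \<Rightarrow> real) \<Rightarrow> (nat \<Rightarrow> 'a::{real_normed_field,banach}) \<Rightarrow> (nat \<Rightarrow> 'a)" where
  "matrix_map A x = (\<lambda>m. \<Sum>n. of_real (A m n) * x n)"

definition witten_term :: "real \<Rightarrow> real \<Rightarrow> real \<Rightarrow> nat \<Rightarrow> nat \<Rightarrow> real" where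
  "witten_term r s t n m =
     1 / (real (Suc n) powr r * real (Suc m) powr s * (real (Suc n) + real (Suc m)) powr t)"

definition witten_converges :: "real \<Rightarrow> real \<Rightarrow> real \<Rightarrow> bool" where
  "witten_converges r s t \<longleftrightarrow>
     (\<forall>n. summable (\<lambda>m. witten_term r s t n m)) \<and>
     summable (\<lambda>n. \<Sum>m. witten_term r s t n m)"

definition witten :: "real \<Rightarrow> real \<Rightarrow> real \<Rightarrow> real" where
  "witten r s t = (\<Sum>n. \<Sum>m. witten_term r s t n m)"

text \<open>The real zeta function, for arguments greater than 1.\<close>

definition zeta :: "real \<Rightarrow> real" where
  "zeta x = (\<Sum>n. real (Suc n) powr (- x))"

definition csc :: "real \<Rightarrow> real" where
  "csc x = 1 / sin x"

end

theory Submission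
  imports Defs
begin

text \<open>
  Let \<open>c(a) = \<pi> / sin (\<pi>a)\<close> for \<open>0 < a < 1\<close>. The Beta integral gives
  \<open>\<integral>\<^sub>0\<^sup>\<infinity> x powr (-a) / (y + x) dx = c(a) y powr (-a)\<close>. Comparing the sum over \<open>m\<close> of
  \<open>m powr (-a) / (y + m)\<close> with this integral yields the upper bound \<open>c(a) y powr (-a)\<close>, and a
  lower bound that is smaller by at most \<open>1 / ((1 - a) y)\<close>.

  The upper bound with \<open>a = 1/p\<close> and \<open>a = 1/q\<close> is what the Schur test (Hoelder's inequality with
  weights \<open>n powr (1/(pq))\<close>) needs to give the operator norm bound \<open>c(1/p)\<close>. Summing both bounds over
  \<open>y = n\<close> shows that \<open>\<W>(s, (p-1)s, 1)\<close> differs from \<open>c((p-1)s) \<zeta>(ps)\<close> by a bounded amount as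
  \<open>s \<rightarrow> 1/p\<close>, while \<open>\<zeta>(ps) \<rightarrow> \<infinity>\<close>; so the quotient tends to \<open>c(1/q) = c(1/p)\<close>. Finally, the Witten sum
  is the pairing of the image of one power sequence with another one, so by Hoelder's inequality the
  quotient is at most the operator norm.
\<close>

section \<open>The Beta integral over the half-line\<close>

lemma Gamma_reflection_real:
  fixes a :: real
  shows "Gamma a * Gamma (1 - a) = pi / sin (pi * a)"
proof -
  have "complex_of_real (Gamma a * Gamma (1 - a)) = complex_of_real (pi / sin (pi * a))"
    using Gamma_reflection_complex[of "complex_of_real a"]
    by (simp flip: Gamma_complex_of_real sin_of_real)
  then show ?thesis
    by (simp only: of_real_eq_iff)
qed

lemma Beta_one_minus:
  fixes a :: real
  shows "Beta (1 - a) a = pi / sin (pi * a)"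
  using Gamma_reflection_real[of a] by (simp add: Beta_def mult.commute)

text \<open>The substitution \<open>x = y * t / (1 - t)\<close> turns the integrand into
  \<open>y powr (- a)\<close> times the integrand of \<open>Beta (1 - a) a\<close> on the unit
  interval, and the reflection formula evaluates that Beta value.\<close>

lemma has_integral_powr_div_add:
  fixes a y :: real
  assumes "0 < a" "a < 1" "0 < y"
  shows "((\<lambda>x. x powr (- a) / (y + x)) has_integral pi / sin (pi * a) * y powr (- a)) {0<..}"
proof -
  define g where "g = (\<lambda>t. y * (t / (1 - t)))"
  define g' where "g' = (\<lambda>t. y / (1 - t)\<^sup>2)"
  let ?f = "\<lambda>x. x powr (- a) / (y + x)"
  let ?h = "\<lambda>t. y powr (- a) * (t powr (- a) * (1 - t) powr (a - 1))"
  have image: "g ` {0<..<1} = {0<..}"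
  proof (intro equalityI subsetI)
    fix x :: real assume "x \<in> {0<..}"
    \<comment> \<open>The preimage of \<open>x\<close> under \<open>g\<close> is
      \<open>x / (y + x)\<close>.\<close>
    then have "1 - x / (y + x) = y / (y + x)"
      using \<open>0 < y\<close> by (simp add: field_simps)
    with \<open>x \<in> {0<..}\<close> have "x = g (x / (y + x))" "x / (y + x) \<in> {0<..<1}"
      using \<open>0 < y\<close> by (simp_all add: g_def)
    then show "x \<in> g ` {0<..<1}"
      by blast
  qed (use \<open>0 < y\<close> in \<open>auto simp: g_def\<close>)
  have inj: "inj_on g {0<..<1}"
    using \<open>0 < y\<close> by (auto simp: inj_on_def g_def field_simps)
  have deriv: "(g has_field_derivative g' t) (at t within {0<..<1})" if "t \<in> {0<..<1}" for t
    using that unfolding g_def g'_def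
    by (auto intro!: derivative_eq_intros simp: field_simps power2_eq_square)
  have subst: "\<bar>g' t\<bar> * ?f (g t) = ?h t" if "t \<in> {0<..<1}" for t
  proof -
    have "y + g t = y / (1 - t)"
      using that by (simp add: g_def field_simps)
    moreover have "g t powr (- a) = y powr (- a) * t powr (- a) * (1 - t) powr a"
      using that \<open>0 < y\<close> by (simp add: g_def powr_mult powr_divide powr_minus field_simps)
    moreover have "(1 - t) powr (a - 1) = (1 - t) powr a / (1 - t)"
      using that by (simp add: powr_diff)
    \<comment> \<open>The remaining algebra, with \<open>u\<close> for \<open>1 - t\<close> and
      \<open>T\<close>, \<open>U\<close> for the powers of \<open>t\<close> and
      \<open>1 - t\<close>.\<close>
    moreover have "y / u\<^sup>2 * (y powr (- a) * T * U / (y / u)) = y powr (- a) * (T * (U / u))"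
      if "0 < u" for u T U :: real
      using that \<open>0 < y\<close> by (simp add: field_simps power2_eq_square)
    ultimately show ?thesis
      using that \<open>0 < y\<close> by (simp add: g'_def)
  qed
  have "((\<lambda>t. t powr (- a) * (1 - t) powr (a - 1)) has_integral pi / sin (pi * a)) {0..1}"
    using has_integral_Beta_real[of "1 - a" a] assms by (simp add: Beta_one_minus)
  from has_integral_mult_right[OF this, of "y powr (- a)"]
  have "(?h has_integral y powr (- a) * (pi / sin (pi * a))) {0..1}" .
  \<comment> \<open>The endpoints form a null set; they are dropped because \<open>g\<close> maps
    only the open interval bijectively onto the half-line.\<close>
  then have "(?h has_integral y powr (- a) * (pi / sin (pi * a))) {0<..<1}"
    by (rule iffD1[OF has_integral_spike_set_eq, rotated 2])
       (auto intro: negligible_subset[of "{0, 1}"])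
  then have h: "((\<lambda>t. \<bar>g' t\<bar> * ?f (g t)) has_integral y powr (- a) * (pi / sin (pi * a))) {0<..<1}"
    by (rule has_integral_eq[rotated]) (rule subst[symmetric])
  \<comment> \<open>The change of variables theorem asks for absolute integrability, which follows
    from integrability since the integrand is nonnegative.\<close>
  then have "(\<lambda>t. \<bar>g' t\<bar> * ?f (g t)) absolutely_integrable_on {0<..<1}"
    by (intro nonnegative_absolutely_integrable_1 has_integral_integrable[OF h])
       (subst subst, auto)
  with h have "?f absolutely_integrable_on g ` {0<..<1} \<and>
      integral (g ` {0<..<1}) ?f = y powr (- a) * (pi / sin (pi * a))"
    by (subst has_absolute_integral_change_of_variables_1'[OF _ deriv inj, symmetric])
       (auto simp: integral_unique)
  then show ?thesis
    unfolding image
    by (metis has_integral_iff mult.commute set_lebesgue_integral_eq_integral(1))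
qed

section \<open>Comparison of sums with integrals\<close>

text \<open>An integral test that tolerates a singularity at 0. On a unit interval an antitone
  \<open>f\<close> lies between its values at the two endpoints. The first interval has no usable
  left endpoint value, so its integral stays in the lower bound as a separate term.\<close>

lemma
  fixes f :: "real \<Rightarrow> real"
  assumes antimono: "\<And>x y. 0 < x \<Longrightarrow> x \<le> y \<Longrightarrow> f y \<le> f x"
    and nonneg: "\<And>x. 0 < x \<Longrightarrow> 0 \<le> f x"
    and I: "(f has_integral I) {0<..}"
  shows summable_antimono_has_integral: "summable (\<lambda>m. f (real (Suc m)))"
    and suminf_antimono_le_integral: "(\<Sum>m. f (real (Suc m))) \<le> I"
    and integral_le_suminf_antimono: "I \<le> integral {0<..1} f + (\<Sum>m. f (real (Suc m)))"
proof -
  \<comment> \<open>Half-open pieces, so that they partition the half-line exactly;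
    \<open>A 0\<close> is the piece next to the singularity.\<close>
  define A where "A m = {real m<..real (Suc m)}" for m
  define J where "J m = (LINT x:A m|lebesgue. f x)" for m
  have f_int: "f absolutely_integrable_on {0<..}"
    using I nonneg by (auto intro: nonnegative_absolutely_integrable_1)
  have A_sets [simp]: "A m \<in> sets lebesgue" "A m \<subseteq> {0<..}" for m
    by (auto simp: A_def)
  have A_int: "f absolutely_integrable_on A m" for m
    by (rule set_integrable_subset[OF f_int]) auto
  have const_int: "(\<lambda>_. c) absolutely_integrable_on A m" for m and c :: real
    by (auto simp: A_def intro!: absolutely_integrable_on_const bounded_set_imp_lmeasurable)
  have LINT_const: "(LINT x:A m|lebesgue. c) = c" for m and c :: real
    by (subst set_integral_const) (auto simp: A_def)
  have disj: "A i \<inter> A j = {}" if "i \<noteq> j" for i j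
    using that by (cases i j rule: linorder_cases) (auto simp: A_def)
  have Union_A: "(\<Union>m. A m) = {0<..}"
  proof (intro equalityI subsetI)
    fix x :: real assume "x \<in> {0<..}"
    then have "x \<in> A (nat (\<lceil>x\<rceil> - 1))"
      unfolding A_def by (auto; linarith)
    then show "x \<in> (\<Union>m. A m)"
      by blast
  qed (use A_sets in blast)
  have J_ge: "f (real (Suc m)) \<le> J m" for m
    unfolding J_def
    by (subst LINT_const[symmetric, of _ m], rule set_integral_mono[OF const_int A_int])
       (auto simp: A_def intro: antimono)
  \<comment> \<open>The value at \<open>Suc m\<close> is the right endpoint value for
    \<open>A m\<close> and the left one for \<open>A (Suc m)\<close>; hence the index shift against
    \<open>J_ge\<close>.\<close>
  have J_le: "J (Suc m) \<le> f (real (Suc m))" for m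
    unfolding J_def
    by (subst (2) LINT_const[symmetric, of _ "Suc m"], rule set_integral_mono[OF A_int const_int])
       (auto simp: A_def intro: antimono)
  have I_eq: "I = (LINT x:{0<..}|lebesgue. f x)"
    using set_lebesgue_integral_eq_integral(2)[OF f_int] I by (simp add: integral_unique)
  have J_nonneg: "0 \<le> J m" for m
    using J_ge[of m] nonneg[of "real (Suc m)"] by simp
  \<comment> \<open>A finite union of pieces lies in the half-line and \<open>f\<close> is
    nonnegative there, so \<open>I\<close> bounds all partial sums.\<close>
  have "(\<Sum>m<M. J m) \<le> I" for M
  proof -
    have "(\<Sum>m<M. J m) = (LINT x:(\<Union>m<M. A m)|lebesgue. f x)"
      unfolding J_def
      by (rule set_integral_finite_Union[symmetric])
         (use disj A_int in \<open>auto simp: disjoint_family_on_def\<close>)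
    also have "\<dots> = integral (\<Union>m<M. A m) f"
      by (rule set_lebesgue_integral_eq_integral(2), rule set_integrable_subset[OF f_int])
         (auto dest: subsetD[OF A_sets(2)])
    also have "\<dots> \<le> integral {0<..} f"
      by (rule integral_subset_le)
         (use nonneg I in \<open>auto dest: subsetD[OF A_sets(2)]
           intro!: set_lebesgue_integral_eq_integral(1) set_integrable_subset[OF f_int]\<close>)
    finally show ?thesis
      using I by (simp add: integral_unique)
  qed
  then have J_summable: "summable J"
    by (rule summableI_nonneg_bounded[OF J_nonneg])
  have I_sum: "I = (\<Sum>m. J m)"
    unfolding I_eq J_def Union_A[symmetric]
    by (rule lebesgue_integral_countable_add) (use disj f_int in \<open>auto simp: Union_A\<close>)
  show summable: "summable (\<lambda>m. f (real (Suc m)))"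
    by (rule summable_comparison_test'[OF J_summable, of 0]) (use J_ge nonneg in auto)
  show "(\<Sum>m. f (real (Suc m))) \<le> I"
    unfolding I_sum by (rule suminf_le[OF J_ge summable J_summable])
  have "I = J 0 + (\<Sum>m. J (Suc m))"
    using I_sum suminf_split_head[OF J_summable] by simp
  also have "(\<Sum>m. J (Suc m)) \<le> (\<Sum>m. f (real (Suc m)))"
    by (rule suminf_le[OF J_le _ summable]) (use J_summable in \<open>simp add: summable_Suc_iff\<close>)
  also have "J 0 = integral {0<..1} f"
    unfolding J_def using set_lebesgue_integral_eq_integral(2)[OF A_int[of 0]] by (simp add: A_def)
  finally show "I \<le> integral {0<..1} f + (\<Sum>m. f (real (Suc m)))"
    by simp
qed

text \<open>The integral test applied to the Beta integrand. The error is its integral over the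
  first unit interval, where \<open>y + x\<close> is at least \<open>y\<close>; so it is at most the
  integral of \<open>x powr (- a) / y\<close>, that is, \<open>1 / ((1 - a) * y)\<close>.\<close>

lemma
  fixes a y :: real
  assumes a: "0 < a" "a < 1" and y: "0 < y"
  shows summable_powr_div_add: "summable (\<lambda>m. real (Suc m) powr (- a) / (y + real (Suc m)))"
    and suminf_powr_div_add_le:
      "(\<Sum>m. real (Suc m) powr (- a) / (y + real (Suc m))) \<le> pi / sin (pi * a) * y powr (- a)"
    and suminf_powr_div_add_ge:
      "pi / sin (pi * a) * y powr (- a) - 1 / ((1 - a) * y)
        \<le> (\<Sum>m. real (Suc m) powr (- a) / (y + real (Suc m)))"
proof -
  let ?f = "\<lambda>x. x powr (- a) / (y + x)"
  note I = has_integral_powr_div_add[OF a y]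
  have antimono: "?f v \<le> ?f u" if "0 < u" "u \<le> v" for u v
    using that a y by (intro frac_le powr_mono2') auto
  have nonneg: "0 \<le> ?f u" if "0 < u" for u
    using that y by simp
  show "summable (\<lambda>m. ?f (real (Suc m)))"
    by (rule summable_antimono_has_integral[OF antimono nonneg I])
  show "(\<Sum>m. ?f (real (Suc m))) \<le> pi / sin (pi * a) * y powr (- a)"
    by (rule suminf_antimono_le_integral[OF antimono nonneg I])
  have "((\<lambda>x. x powr (- a)) has_integral 1 / (1 - a)) {0..1}"
    using has_integral_powr_from_0[of "- a" 1] a by simp
  then have "((\<lambda>x. x powr (- a)) has_integral 1 / (1 - a)) {0<..1}"
    by (rule iffD1[OF has_integral_spike_set_eq, rotated 2])
       (auto intro: negligible_subset[of "{0}"])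
  from has_integral_divide[OF this, of y]
  have tail: "((\<lambda>x. x powr (- a) / y) has_integral 1 / ((1 - a) * y)) {0<..1}"
    by simp
  have "?f absolutely_integrable_on {0<..1}"
    by (rule set_integrable_subset[of _ "{0<..}"])
       (use I nonneg in \<open>auto intro: nonnegative_absolutely_integrable_1\<close>)
  then have "(?f has_integral integral {0<..1} ?f) {0<..1}"
    using set_lebesgue_integral_eq_integral(1) by blast
  then have "integral {0<..1} ?f \<le> 1 / ((1 - a) * y)"
    by (rule has_integral_le[OF _ tail]) (use y in \<open>auto intro: frac_le\<close>)
  with integral_le_suminf_antimono[OF antimono nonneg I]
  show "pi / sin (pi * a) * y powr (- a) - 1 / ((1 - a) * y) \<le> (\<Sum>m. ?f (real (Suc m)))"
    by simp
qed

section \<open>The zeta function near 1\<close>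

lemma summable_Suc_powr:
  assumes "1 < x"
  shows "summable (\<lambda>n. real (Suc n) powr (- x))"
  using assms summable_real_powr_iff[of "- x"] summable_Suc_iff[of "\<lambda>n. real n powr (- x)"] by simp

lemma zeta_pos:
  assumes "1 < x"
  shows "0 < zeta x"
  unfolding zeta_def by (rule suminf_pos[OF summable_Suc_powr[OF assms]]) simp

lemma zeta_antimono:
  assumes "1 < x" "x \<le> y"
  shows "zeta y \<le> zeta x"
  unfolding zeta_def
  by (rule suminf_le) (use assms in \<open>auto intro!: summable_Suc_powr powr_mono simp del: of_nat_Suc\<close>)

text \<open>Some partial sum of the harmonic series exceeds a given \<open>Z\<close>. As a finite
  sum it is continuous in the exponent, so it still exceeds \<open>Z\<close> slightly to the right
  of 1, and there \<open>zeta\<close> dominates it.\<close>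

lemma filterlim_zeta_at_right_1: "filterlim zeta at_top (at_right 1)"
  unfolding filterlim_at_top
proof
  fix Z :: real
  have "\<not> summable (\<lambda>n. real (Suc n) powr (- 1))"
    using summable_real_powr_iff[of "- 1"] summable_Suc_iff[of "\<lambda>n. real n powr (- 1)"] by simp
  then obtain N where N: "Z < (\<Sum>n<N. real (Suc n) powr (- 1))"
    using summableI_nonneg_bounded[of "\<lambda>n. real (Suc n) powr (- 1)" Z] by (metis not_le powr_ge_zero)
  have "((\<lambda>x. \<Sum>n<N. real (Suc n) powr (- x)) \<longlongrightarrow> (\<Sum>n<N. real (Suc n) powr (- 1))) (at_right 1)"
    by (intro tendsto_intros) auto
  then have "\<forall>\<^sub>F x in at_right 1. Z < (\<Sum>n<N. real (Suc n) powr (- x))"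
    using N by (rule order_tendstoD)
  moreover have "\<forall>\<^sub>F x::real in at_right 1. 1 < x"
    by (simp add: eventually_at_right_less)
  ultimately show "\<forall>\<^sub>F x in at_right 1. Z \<le> zeta x"
  proof eventually_elim
    case (elim x)
    have "(\<Sum>n<N. real (Suc n) powr (- x)) \<le> zeta x"
      unfolding zeta_def by (rule sum_le_suminf[OF summable_Suc_powr]) (use elim in auto)
    with elim show ?case
      by simp
  qed
qed

section \<open>Bounds for the Witten sums\<close>

lemma witten_term_1:
  "witten_term r s 1 n m =
    real (Suc n) powr (- r) * (real (Suc m) powr (- s) / (real (Suc n) + real (Suc m)))"
  by (simp add: witten_term_def powr_minus field_simps del: of_nat_Suc)

text \<open>The previous bounds at \<open>y = real (Suc n)\<close>, multiplied by
  \<open>y powr (- r)\<close>. The error then has exponent \<open>1 + r\<close>, so for positive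
  \<open>r\<close> it is summable over \<open>n\<close> with a sum that does not blow up as
  \<open>r + a\<close> approaches 1.\<close>

lemma
  fixes r a :: real
  assumes a: "0 < a" "a < 1"
  shows summable_witten_inner: "summable (\<lambda>m. witten_term r a 1 n m)"
    and witten_inner_le: "(\<Sum>m. witten_term r a 1 n m) \<le> pi / sin (pi * a) * real (Suc n) powr (- (r + a))"
    and witten_inner_ge: "pi / sin (pi * a) * real (Suc n) powr (- (r + a))
      - real (Suc n) powr (- (1 + r)) / (1 - a) \<le> (\<Sum>m. witten_term r a 1 n m)"
proof -
  let ?N = "real (Suc n)"
  note S = summable_powr_div_add[OF a, of ?N]
  show "summable (\<lambda>m. witten_term r a 1 n m)"
    unfolding witten_term_1 by (intro summable_mult S) simp
  have eq: "(\<Sum>m. witten_term r a 1 n m)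
      = ?N powr (- r) * (\<Sum>m. real (Suc m) powr (- a) / (?N + real (Suc m)))"
    unfolding witten_term_1 by (intro suminf_mult S) simp
  have "?N powr (- r) * (\<Sum>m. real (Suc m) powr (- a) / (?N + real (Suc m)))
      \<le> ?N powr (- r) * (pi / sin (pi * a) * ?N powr (- a))"
    by (intro mult_left_mono suminf_powr_div_add_le a) auto
  also have "\<dots> = pi / sin (pi * a) * ?N powr (- (r + a))"
    by (simp add: powr_add powr_diff powr_minus field_simps)
  finally show "(\<Sum>m. witten_term r a 1 n m) \<le> pi / sin (pi * a) * ?N powr (- (r + a))"
    unfolding eq .
  have "pi / sin (pi * a) * ?N powr (- (r + a)) - ?N powr (- (1 + r)) / (1 - a)
      = ?N powr (- r) * (pi / sin (pi * a) * ?N powr (- a)) - ?N powr (- r) * (?N powr (- 1) / (1 - a))"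
  proof -
    have "?N powr (- (r + a)) = ?N powr (- r) * ?N powr (- a)"
        "?N powr (- (1 + r)) = ?N powr (- r) * ?N powr (- 1)"
      by (simp_all only: powr_add[symmetric]) (simp_all add: algebra_simps)
    then show ?thesis
      by (simp only: mult.left_commute times_divide_eq_right)
  qed
  also have "\<dots> = ?N powr (- r) * (pi / sin (pi * a) * ?N powr (- a) - 1 / ((1 - a) * ?N))"
    by (simp add: powr_minus_divide algebra_simps)
  also have "\<dots> \<le> ?N powr (- r) * (\<Sum>m. real (Suc m) powr (- a) / (?N + real (Suc m)))"
    by (intro mult_left_mono suminf_powr_div_add_ge a) auto
  finally show "pi / sin (pi * a) * ?N powr (- (r + a)) - ?N powr (- (1 + r)) / (1 - a)
      \<le> (\<Sum>m. witten_term r a 1 n m)"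
    unfolding eq .
qed

lemma witten_term_nonneg: "0 \<le> witten_term r s t n m"
  by (simp add: witten_term_def)

text \<open>The inner bound requires an exponent below 1. A larger \<open>s\<close> is replaced by a
  smaller \<open>a\<close>, which only increases the terms.\<close>

lemma witten_converges_1:
  assumes "0 < r" "0 < s" "1 < r + s"
  shows "witten_converges r s 1"
proof -
  \<comment> \<open>If \<open>s\<close> is below 1, it serves as \<open>a\<close> itself. Otherwise
    \<open>a\<close> is taken between \<open>max 0 (1 - r)\<close> and 1, a nonempty range because
    \<open>r\<close> is positive.\<close>
  obtain a where a: "0 < a" "a < 1" "a \<le> s" "1 < r + a"
  proof (cases "s < 1")
    case False
    obtain a where "max 0 (1 - r) < a" "a < 1"
      using dense[of "max 0 (1 - r)" 1] \<open>0 < r\<close> by auto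
    with False that[of a] show ?thesis
      by auto
  qed (use assms that[of s] in auto)
  have le: "witten_term r s 1 n m \<le> witten_term r a 1 n m" for n m
    unfolding witten_term_1 using a
    by (intro mult_left_mono divide_right_mono powr_mono) auto
  have inner: "summable (\<lambda>m. witten_term r s 1 n m)" for n
    by (rule summable_comparison_test'[OF summable_witten_inner[OF a(1,2), of r n], of 0])
       (use le witten_term_nonneg in auto)
  have "summable (\<lambda>n. pi / sin (pi * a) * real (Suc n) powr (- (r + a)))"
    using a by (intro summable_mult summable_Suc_powr)
  then have "summable (\<lambda>n. \<Sum>m. witten_term r s 1 n m)"
  proof (rule summable_comparison_test'[where N = 0])
    fix n
    have "(\<Sum>m. witten_term r s 1 n m) \<le> (\<Sum>m. witten_term r a 1 n m)"
      by (intro suminf_le le inner summable_witten_inner a)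
    also have "\<dots> \<le> pi / sin (pi * a) * real (Suc n) powr (- (r + a))"
      by (rule witten_inner_le[OF a(1,2)])
    finally show "norm (\<Sum>m. witten_term r s 1 n m) \<le> pi / sin (pi * a) * real (Suc n) powr (- (r + a))"
      using suminf_nonneg[OF inner witten_term_nonneg, of n] by simp
  qed
  with inner show ?thesis
    by (simp add: witten_converges_def)
qed

lemma
  fixes r a :: real
  assumes r: "0 < r" and a: "0 < a" "a < 1" and ra: "1 < r + a"
  shows witten_le_zeta: "witten r a 1 \<le> pi / sin (pi * a) * zeta (r + a)"
    and witten_ge_zeta: "pi / sin (pi * a) * zeta (r + a) - zeta (1 + r) / (1 - a) \<le> witten r a 1"
proof -
  have W: "summable (\<lambda>n. \<Sum>m. witten_term r a 1 n m)"
    using witten_converges_1[OF r a(1) ra] by (simp add: witten_converges_def)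
  have Z: "(\<lambda>n. pi / sin (pi * a) * real (Suc n) powr (- (r + a))) sums (pi / sin (pi * a) * zeta (r + a))"
    unfolding zeta_def using ra by (intro sums_mult summable_sums summable_Suc_powr)
  have Z': "(\<lambda>n. real (Suc n) powr (- (1 + r)) / (1 - a)) sums (zeta (1 + r) / (1 - a))"
    unfolding zeta_def using r by (intro sums_divide summable_sums summable_Suc_powr) simp
  show "witten r a 1 \<le> pi / sin (pi * a) * zeta (r + a)"
    unfolding witten_def by (rule sums_le[OF witten_inner_le[OF a] summable_sums[OF W] Z])
  show "pi / sin (pi * a) * zeta (r + a) - zeta (1 + r) / (1 - a) \<le> witten r a 1"
    unfolding witten_def by (rule sums_le[OF witten_inner_ge[OF a] sums_diff[OF Z Z'] summable_sums[OF W]])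
qed

section \<open>The limit of the quotient\<close>

lemma sin_pi_conjugate:
  fixes p q :: real
  assumes "1 / p + 1 / q = 1"
  shows "sin (pi * (1 / q)) = sin (pi / p)"
proof -
  have "pi * (1 / q) = pi - pi / p"
    using arg_cong[OF assms, of "\<lambda>x. pi * x"] by (simp add: distrib_left)
  then show ?thesis
    by simp
qed

text \<open>With \<open>r = s\<close> and \<open>a = (p - 1) * s\<close> one has
  \<open>r + a = p * s\<close>, so division by \<open>zeta (p * s)\<close> squeezes the quotient
  between \<open>pi / sin (pi * a)\<close> and the same minus a vanishing error. The limit is taken
  from the right because the zeta series requires \<open>p * s\<close> above 1.\<close>

lemma witten_div_zeta_tendsto:
  fixes p q :: real
  assumes p: "1 < p" and q: "1 < q" and pq: "1 / p + 1 / q = 1"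
  shows "((\<lambda>s. witten s ((p - 1) * s) 1 / zeta (p * s)) \<longlongrightarrow> pi * csc (pi / p)) (at_right (1 / p))"
proof -
  let ?F = "at_right (1 / p)"
  let ?c = "\<lambda>s. pi / sin (pi * ((p - 1) * s))"
  have q_eq: "(p - 1) * (1 / p) = 1 / q"
    using p pq by (simp add: field_simps)
  have p_cancel: "p * (1 / p) = 1"
    using p by simp
  have id: "((\<lambda>s. s) \<longlongrightarrow> 1 / p) ?F"
    by (rule tendsto_ident_at)
  have a_lim: "((\<lambda>s. (p - 1) * s) \<longlongrightarrow> 1 / q) ?F"
    using tendsto_mult_left[OF id, of "p - 1"] unfolding q_eq .
  have sin_pos: "0 < sin (pi / p)"
    using p by (intro sin_gt_zero) (auto simp: field_simps)
  have c_lim: "(?c \<longlongrightarrow> pi * csc (pi / p)) ?F"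
    using tendsto_divide[OF tendsto_const tendsto_sin[OF tendsto_mult_left[OF a_lim, of pi]], of pi]
      sin_pos sin_pi_conjugate[OF pq] by (simp add: csc_def)
  have gt: "\<forall>\<^sub>F s in ?F. 1 / p < s"
    by (simp add: eventually_at_right_less)
  \<comment> \<open>The Witten bounds require \<open>a\<close> below 1; near the limit point this
    holds since \<open>1 / q\<close> is below 1.\<close>
  have lt: "\<forall>\<^sub>F s in ?F. (p - 1) * s < 1"
    by (rule order_tendstoD(2)[OF a_lim]) (use q in simp)
  have "((\<lambda>s. p * s) \<longlongrightarrow> 1) ?F"
    using tendsto_mult_left[OF id, of p] unfolding p_cancel .
  moreover have "\<forall>\<^sub>F s in ?F. p * s \<in> {1<..} \<and> p * s \<noteq> 1"
    using gt by eventually_elim (use p in \<open>auto simp: field_simps\<close>)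
  ultimately have "filterlim (\<lambda>s. p * s) (at_right 1) ?F"
    unfolding filterlim_at by simp
  then have zeta_lim: "filterlim (\<lambda>s. zeta (p * s)) at_top ?F"
    by (rule filterlim_compose[OF filterlim_zeta_at_right_1])
  \<comment> \<open>The error contains \<open>zeta (1 + s)\<close>. Monotonicity replaces it by the
    constant \<open>zeta (1 + 1 / p)\<close>, so continuity of \<open>zeta\<close> does not
    enter.\<close>
  have "((\<lambda>s. zeta (1 + 1 / p) / (1 - (p - 1) * s)) \<longlongrightarrow> zeta (1 + 1 / p) / (1 - 1 / q)) ?F"
    using q by (intro tendsto_intros a_lim) simp
  then have "((\<lambda>s. zeta (1 + 1 / p) / (1 - (p - 1) * s) / zeta (p * s)) \<longlongrightarrow> 0) ?F"
    by (rule tendsto_divide_0[OF _ filterlim_at_top_imp_at_infinity[OF zeta_lim]])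
  from tendsto_diff[OF c_lim this]
  have lower: "((\<lambda>s. ?c s - zeta (1 + 1 / p) / (1 - (p - 1) * s) / zeta (p * s))
      \<longlongrightarrow> pi * csc (pi / p)) ?F"
    by simp
  have bounds: "\<forall>\<^sub>F s in ?F. ?c s - zeta (1 + 1 / p) / (1 - (p - 1) * s) / zeta (p * s)
        \<le> witten s ((p - 1) * s) 1 / zeta (p * s) \<and>
      witten s ((p - 1) * s) 1 / zeta (p * s) \<le> ?c s"
    using gt lt
  proof eventually_elim
    case (elim s)
    have s: "0 < s"
      using elim(1) p by (smt (verit) divide_pos_pos)
    have ps: "1 < p * s"
      using elim(1) p by (simp add: field_simps)
    have eq: "s + (p - 1) * s = p * s"
      by (simp add: algebra_simps)
    have a: "0 < (p - 1) * s"
      using s p by simp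
    note zeta_pos = zeta_pos[OF ps]
    have "witten s ((p - 1) * s) 1 \<le> ?c s * zeta (p * s)"
      using witten_le_zeta[OF s a elim(2)] ps by (simp only: eq)
    moreover have "?c s * zeta (p * s) - zeta (1 + s) / (1 - (p - 1) * s) \<le> witten s ((p - 1) * s) 1"
      using witten_ge_zeta[OF s a elim(2)] ps by (simp only: eq)
    moreover have "zeta (1 + s) / (1 - (p - 1) * s) \<le> zeta (1 + 1 / p) / (1 - (p - 1) * s)"
      using elim p by (intro divide_right_mono zeta_antimono) auto
    ultimately have "(?c s * zeta (p * s) - zeta (1 + 1 / p) / (1 - (p - 1) * s)) / zeta (p * s)
          \<le> witten s ((p - 1) * s) 1 / zeta (p * s)"
        "witten s ((p - 1) * s) 1 / zeta (p * s) \<le> ?c s * zeta (p * s) / zeta (p * s)"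
      using zeta_pos by - (rule divide_right_mono, linarith, linarith)+
    then show ?case
      using zeta_pos by (simp add: diff_divide_distrib)
  qed
  show ?thesis
    by (rule tendsto_sandwich[OF _ _ lower c_lim]) (use bounds in \<open>auto elim: eventually_mono\<close>)
qed

section \<open>Hoelder's inequality for series\<close>

text \<open>Young's inequality is applied termwise to the sequences divided by their norms
  \<open>A'\<close> and \<open>B'\<close>; the right-hand sides sum to
  \<open>1 / p + 1 / q = 1\<close>.\<close>

lemma
  fixes p q :: real and a b :: "nat \<Rightarrow> real"
  assumes p: "1 < p" and q: "1 < q" and pq: "1 / p + 1 / q = 1"
    and nonneg: "\<And>n. 0 \<le> a n" "\<And>n. 0 \<le> b n"
    and a: "summable (\<lambda>n. a n powr p)" and b: "summable (\<lambda>n. b n powr q)"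
  shows summable_Holder: "summable (\<lambda>n. a n * b n)"
    and suminf_Holder: "(\<Sum>n. a n * b n)
      \<le> (\<Sum>n. a n powr p) powr (1 / p) * (\<Sum>n. b n powr q) powr (1 / q)"
proof -
  note young = Youngs_inequality[OF p q pq]
  have "summable (\<lambda>n. a n powr p / p + b n powr q / q)"
    by (intro summable_add summable_divide a b)
  then show ab: "summable (\<lambda>n. a n * b n)"
    by (rule summable_comparison_test'[of _ 0]) (use young nonneg in auto)
  define A where "A = (\<Sum>n. a n powr p)"
  define B where "B = (\<Sum>n. b n powr q)"
  have "0 \<le> A" "0 \<le> B"
    unfolding A_def B_def by (intro suminf_nonneg a b; simp)+
  \<comment> \<open>A sequence of norm zero cannot be normalised, but then it vanishes
    identically.\<close>
  then consider "A = 0" | "B = 0" | "0 < A" "0 < B"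
    by force
  then show "(\<Sum>n. a n * b n) \<le> A powr (1 / p) * B powr (1 / q)"
  proof cases
    assume "A = 0"
    then have "a n = 0" for n
      using suminf_eq_zero_iff[OF a] by (simp add: A_def)
    then show ?thesis
      by simp
  next
    assume "B = 0"
    then have "b n = 0" for n
      using suminf_eq_zero_iff[OF b] by (simp add: B_def)
    then show ?thesis
      by simp
  next
    assume A: "0 < A" and B: "0 < B"
    define A' where "A' = A powr (1 / p)"
    define B' where "B' = B powr (1 / q)"
    have A': "0 < A'" "A' powr p = A" and B': "0 < B'" "B' powr q = B"
      using A B p q by (simp_all add: A'_def B'_def powr_powr)
    have "(\<Sum>n. a n / A' * (b n / B')) \<le> (\<Sum>n. a n powr p / A / p + b n powr q / B / q)"
    proof (rule suminf_le)
      fix n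
      show "a n / A' * (b n / B') \<le> a n powr p / A / p + b n powr q / B / q"
        using young[of "a n / A'" "b n / B'"] A' B' nonneg by (simp add: powr_divide)
      show "summable (\<lambda>n. a n / A' * (b n / B'))"
        using summable_divide[OF ab, of "A' * B'"] by simp
      show "summable (\<lambda>n. a n powr p / A / p + b n powr q / B / q)"
        by (intro summable_add summable_divide a b)
    qed
    also have "\<dots> = A / A / p + B / B / q"
      unfolding A_def B_def
      by (simp add: suminf_add[symmetric] suminf_divide a b summable_divide)
    also have "\<dots> = 1"
      using A B pq by simp
    finally have "(\<Sum>n. a n * b n) / (A' * B') \<le> 1"
      using suminf_divide[OF ab, of "A' * B'"] by simp
    then show ?thesis
      using A' B' by (simp add: A'_def B'_def)
  qed
qed

section \<open>The Schur test for the Hilbert matrix\<close>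

lemma csc_pi_div_pos:
  assumes "1 < p"
  shows "0 < pi * csc (pi / p)"
proof -
  have "0 < sin (pi / p)"
    using assms by (intro sin_gt_zero) (auto simp: field_simps)
  then show ?thesis
    by (simp add: csc_def)
qed

lemma hilbert_matrix_sym: "hilbert_matrix m n = hilbert_matrix n m"
  by (simp add: hilbert_matrix_def add.commute)

lemma hilbert_matrix_pos: "0 < hilbert_matrix m n"
  by (simp add: hilbert_matrix_def add_pos_pos)

lemma hilbert_matrix_le: "hilbert_matrix m n \<le> real (Suc n) powr (- 1)"
  by (simp add: hilbert_matrix_def powr_minus field_simps)

text \<open>The test condition of the Schur test: the matrix maps a power sequence below a multiple
  of itself.\<close>

lemma
  assumes "0 < a" "a < 1"
  shows summable_hilbert_matrix_powr: "summable (\<lambda>n. hilbert_matrix m n * real (Suc n) powr (- a))"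
    and suminf_hilbert_matrix_powr_le:
      "(\<Sum>n. hilbert_matrix m n * real (Suc n) powr (- a)) \<le> pi / sin (pi * a) * real (Suc m) powr (- a)"
  using summable_powr_div_add[OF assms, of "real (Suc m)"]
    suminf_powr_div_add_le[OF assms, of "real (Suc m)"]
  by (simp_all add: hilbert_matrix_def del: of_nat_Suc)

text \<open>Schur test: Hoelder's inequality along each row, with a power weight distributed over
  the two factors, then summation over the rows. Row and column estimates use the exponents
  \<open>1 / p\<close> and \<open>1 / q\<close>, and both give the same constant
  \<open>c\<close>.\<close>

lemma
  fixes p q :: real and x :: "nat \<Rightarrow> real"
  assumes p: "1 < p" and q: "1 < q" and pq: "1 / p + 1 / q = 1"
    and nonneg: "\<And>n. 0 \<le> x n" and x: "summable (\<lambda>n. x n powr p)"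
  shows summable_hilbert_matrix_row: "summable (\<lambda>n. hilbert_matrix m n * x n)"
    and summable_hilbert_matrix_map: "summable (\<lambda>m. (\<Sum>n. hilbert_matrix m n * x n) powr p)"
    and suminf_hilbert_matrix_map_le: "(\<Sum>m. (\<Sum>n. hilbert_matrix m n * x n) powr p)
      \<le> (pi * csc (pi / p)) powr p * (\<Sum>n. x n powr p)"
proof -
  let ?h = hilbert_matrix
  define c where "c = pi * csc (pi / p)"
  have c: "0 < c"
    unfolding c_def by (rule csc_pi_div_pos[OF p])
  have c_eq: "pi / sin (pi * (1 / p)) = c" "pi / sin (pi * (1 / q)) = c"
    using sin_pi_conjugate[OF pq] by (simp_all add: c_def csc_def)
  have p': "0 < 1 / p" "1 / p < 1" and q': "0 < 1 / q" "1 / q < 1"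
    using p q by auto
  \<comment> \<open>The weight exponent \<open>1 / (p * q)\<close> becomes \<open>1 / q\<close> in
    the \<open>p\<close>-th power of \<open>a\<close> and \<open>- (1 / p)\<close> in the
    \<open>q\<close>-th power of \<open>b\<close>, matching the two power sequences of the
    test.\<close>
  define a where "a m n = ?h m n powr (1 / p) * real (Suc n) powr (1 / (p * q)) * x n" for m n
  define b where "b m n = ?h m n powr (1 / q) * real (Suc n) powr (- (1 / (p * q)))" for m n
  have ab: "a m n * b m n = ?h m n * x n" for m n
  proof -
    have "?h m n powr (1 / p) * ?h m n powr (1 / q) = ?h m n"
      using hilbert_matrix_pos[of m n] by (simp add: powr_add[symmetric] pq)
    moreover have "real (Suc n) powr (1 / (p * q)) * real (Suc n) powr (- (1 / (p * q))) = 1"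
      by (simp add: powr_add[symmetric] del: of_nat_Suc)
    moreover have "a m n * b m n = (?h m n powr (1 / p) * ?h m n powr (1 / q)) *
        (real (Suc n) powr (1 / (p * q)) * real (Suc n) powr (- (1 / (p * q)))) * x n"
      by (simp add: a_def b_def)
    ultimately show ?thesis
      by simp
  qed
  have a_powr: "a m n powr p = ?h m n * real (Suc n) powr (1 / q) * x n powr p" for m n
    using p q nonneg hilbert_matrix_pos[of m n]
    by (simp add: a_def powr_mult powr_powr del: of_nat_Suc)
  have b_powr: "b m n powr q = ?h m n * real (Suc n) powr (- (1 / p))" for m n
    using p q hilbert_matrix_pos[of m n]
    by (simp add: b_def powr_mult powr_powr del: of_nat_Suc)
  have a_nonneg: "0 \<le> a m n" and b_nonneg: "0 \<le> b m n" for m n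
    using nonneg by (simp_all add: a_def b_def)
  have a_summable: "summable (\<lambda>n. a m n powr p)" for m
    unfolding a_powr
  proof (rule summable_comparison_test'[OF x, of 0])
    fix n
    \<comment> \<open>The entry decays like \<open>1 / Suc n\<close> and so absorbs the growing
      weight, whose exponent is below 1.\<close>
    have "?h m n * real (Suc n) powr (1 / q) \<le> real (Suc n) powr (- 1) * real (Suc n) powr (1 / q)"
      by (intro mult_right_mono hilbert_matrix_le) auto
    also have "\<dots> = real (Suc n) powr (1 / q - 1)"
      by (simp add: powr_add[symmetric] powr_diff del: of_nat_Suc)
    also have "\<dots> \<le> real (Suc n) powr 0"
      using q' by (intro powr_mono) auto
    finally have "?h m n * real (Suc n) powr (1 / q) \<le> 1"
      by simp
    then have "?h m n * real (Suc n) powr (1 / q) * x n powr p \<le> 1 * x n powr p"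
      by (rule mult_right_mono) simp
    then show "norm (?h m n * real (Suc n) powr (1 / q) * x n powr p) \<le> x n powr p"
      using hilbert_matrix_pos[of m n] by simp
  qed
  have b_summable: "summable (\<lambda>n. b m n powr q)" for m
    unfolding b_powr by (rule summable_hilbert_matrix_powr[OF p'])
  show row: "summable (\<lambda>n. ?h m n * x n)" for m
    using summable_Holder[OF p q pq a_nonneg b_nonneg a_summable b_summable, of m m]
    unfolding ab .
  define u where "u m = (\<Sum>n. ?h m n * x n)" for m
  have u_nonneg: "0 \<le> u m" for m
    unfolding u_def by (intro suminf_nonneg row) (simp add: nonneg hilbert_matrix_pos less_imp_le)
  define S where "S m = (\<Sum>n. a m n powr p)" for m
  have S_nonneg: "0 \<le> S m" for m
    unfolding S_def by (intro suminf_nonneg a_summable) simp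
  have u_powr: "u m powr p \<le> c powr (p - 1) * (real (Suc m) powr (- (1 / q)) * S m)" for m
  proof -
    have "u m \<le> S m powr (1 / p) * (\<Sum>n. b m n powr q) powr (1 / q)"
      using suminf_Holder[OF p q pq a_nonneg b_nonneg a_summable b_summable, of m m]
      unfolding ab by (simp add: u_def S_def)
    also have "\<dots> \<le> S m powr (1 / p) * (c * real (Suc m) powr (- (1 / p))) powr (1 / q)"
      using suminf_hilbert_matrix_powr_le[OF p', of m] q b_summable unfolding c_eq b_powr
      by (intro mult_left_mono powr_mono2) (auto intro!: suminf_nonneg simp: less_imp_le hilbert_matrix_pos)
    finally have "u m powr p \<le> (S m powr (1 / p) * (c * real (Suc m) powr (- (1 / p))) powr (1 / q)) powr p"
      using u_nonneg p by (intro powr_mono2) auto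
    \<comment> \<open>The exponent \<open>- (1 / p)\<close> is multiplied by \<open>1 / q\<close>
      and by \<open>p\<close>, which leaves \<open>- (1 / q)\<close>.\<close>
    also have "\<dots> = S m * (c powr (p / q) * real (Suc m) powr (- (1 / q)))"
      using S_nonneg c p by (simp add: powr_mult powr_powr del: of_nat_Suc)
    also have "p / q = p - 1"
      using pq p q by (simp add: field_simps)
    finally show ?thesis
      by (simp add: mult_ac)
  qed
  \<comment> \<open>With only finitely many rows, exchanging the sums is additivity of series. The
    bound is uniform in \<open>M\<close>, hence gives both convergence and the estimate.\<close>
  have bound: "(\<Sum>m<M. u m powr p) \<le> c powr p * (\<Sum>n. x n powr p)" for M
  proof -
    let ?col = "\<lambda>m n. real (Suc m) powr (- (1 / q)) * a m n powr p"
    have col: "summable (?col m)" for m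
      by (intro summable_mult a_summable)
    have "(\<Sum>m<M. u m powr p) \<le> c powr (p - 1) * (\<Sum>m<M. real (Suc m) powr (- (1 / q)) * S m)"
      unfolding sum_distrib_left by (intro sum_mono u_powr)
    also have "(\<Sum>m<M. real (Suc m) powr (- (1 / q)) * S m) = (\<Sum>m<M. \<Sum>n. ?col m n)"
      by (simp add: S_def suminf_mult a_summable)
    also have "\<dots> = (\<Sum>n. \<Sum>m<M. ?col m n)"
      by (intro suminf_sum[symmetric] col)
    also have "\<dots> \<le> (\<Sum>n. c * x n powr p)"
    proof (intro suminf_le summable_sum col summable_mult x)
      fix n
      \<comment> \<open>Symmetry of the matrix turns the column sum into a row sum with exponent
        \<open>1 / q\<close>; its bound cancels the weight
        \<open>real (Suc n) powr (1 / q)\<close>.\<close>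
      have "(\<Sum>m<M. ?col m n) = (\<Sum>m<M. ?h n m * real (Suc m) powr (- (1 / q))) *
          (real (Suc n) powr (1 / q) * x n powr p)"
        by (simp add: a_powr sum_distrib_left mult_ac hilbert_matrix_sym[of _ n] del: of_nat_Suc)
      also have "\<dots> \<le> c * real (Suc n) powr (- (1 / q)) * (real (Suc n) powr (1 / q) * x n powr p)"
      proof (rule mult_right_mono)
        have "(\<Sum>m<M. ?h n m * real (Suc m) powr (- (1 / q)))
            \<le> (\<Sum>m. ?h n m * real (Suc m) powr (- (1 / q)))"
          by (intro sum_le_suminf summable_hilbert_matrix_powr q') (auto simp: hilbert_matrix_pos less_imp_le)
        also have "\<dots> \<le> c * real (Suc n) powr (- (1 / q))"
          using suminf_hilbert_matrix_powr_le[OF q', of n] unfolding c_eq .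
        finally show "(\<Sum>m<M. ?h n m * real (Suc m) powr (- (1 / q))) \<le> c * real (Suc n) powr (- (1 / q))" .
      qed auto
      also have "\<dots> = c * x n powr p"
        by (simp add: powr_minus del: of_nat_Suc)
      finally show "(\<Sum>m<M. ?col m n) \<le> c * x n powr p" .
    qed
    also have "\<dots> = c * (\<Sum>n. x n powr p)"
      by (rule suminf_mult[OF x])
    finally have "(\<Sum>m<M. u m powr p) \<le> c powr (p - 1) * (c * (\<Sum>n. x n powr p))"
      by (simp add: mult_left_mono)
    also have "\<dots> = c powr p * (\<Sum>n. x n powr p)"
      using c by (simp add: powr_diff)
    finally show ?thesis .
  qed
  show map: "summable (\<lambda>m. (\<Sum>n. ?h m n * x n) powr p)"
    using bound by (intro summableI_nonneg_bounded) (auto simp: u_def)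
  show "(\<Sum>m. (\<Sum>n. ?h m n * x n) powr p) \<le> (pi * csc (pi / p)) powr p * (\<Sum>n. x n powr p)"
    using bound by (intro suminf_le_const map) (auto simp: u_def c_def)
qed

section \<open>Norms of sequences and operators\<close>

lemma suminf_eq_lp_norm_powr:
  assumes "x \<in> lp_space p" "0 < p"
  shows "(\<Sum>n. norm (x n) powr p) = lp_norm p x powr p"
proof -
  have "0 \<le> (\<Sum>n. norm (x n) powr p)"
    using assms by (intro suminf_nonneg) (auto simp: lp_space_def)
  then show ?thesis
    using assms by (simp add: lp_norm_def powr_powr)
qed

lemma lp_norm_nonneg: "0 \<le> lp_norm p x"
  by (simp add: lp_norm_def)

lemma lp_norm_le_iff:
  assumes "x \<in> lp_space p" "0 < p" "0 \<le> C"
  shows "lp_norm p x \<le> C \<longleftrightarrow> (\<Sum>n. norm (x n) powr p) \<le> C powr p"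
  using suminf_eq_lp_norm_powr[OF assms(1,2)] powr_mono2[of p "lp_norm p x" C]
    powr_less_mono2[of p C "lp_norm p x"] lp_norm_nonneg[of p x] assms by fastforce

lemma lp_space_scale:
  assumes "x \<in> lp_space p"
  shows "(\<lambda>n. c * x n) \<in> lp_space p"
  using assms summable_mult[of "\<lambda>n. norm (x n) powr p" "norm c powr p"]
  by (simp add: lp_space_def norm_mult powr_mult)

lemma lp_norm_scale:
  assumes "x \<in> lp_space p" "0 < p"
  shows "lp_norm p (\<lambda>n. c * x n) = norm c * lp_norm p x"
proof -
  have "0 \<le> (\<Sum>n. norm (x n) powr p)"
    using assms by (intro suminf_nonneg) (auto simp: lp_space_def)
  then show ?thesis
    using assms by (simp add: lp_norm_def lp_space_def norm_mult powr_mult suminf_mult powr_powr)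
qed

text \<open>Rescaling to norm one reduces the first claim to the unit sphere. Boundedness of
  \<open>T\<close> makes the real supremum an upper bound, and for the second claim the sphere must
  be nonempty.\<close>

lemma
  fixes T :: "(nat \<Rightarrow> 'a::real_normed_field) \<Rightarrow> (nat \<Rightarrow> 'a)"
  assumes T: "lp_bounded_linear p T" and p: "0 < p"
  shows lp_norm_le_opnorm: "\<And>x. x \<in> lp_space p \<Longrightarrow> 0 < lp_norm p x \<Longrightarrow>
      lp_norm p (T x) \<le> lp_opnorm p T * lp_norm p x"
    and lp_opnorm_le: "\<And>C. (\<And>x. x \<in> lp_space p \<Longrightarrow> lp_norm p (T x) \<le> C * lp_norm p x) \<Longrightarrow>
      lp_opnorm p T \<le> C"
proof -
  let ?U = "{x \<in> lp_space p. lp_norm p x = 1} :: (nat \<Rightarrow> 'a) set"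
  obtain C where C: "lp_norm p (T x) \<le> C * lp_norm p x" if "x \<in> lp_space p" for x
    using T unfolding lp_bounded_linear_def by blast
  have bdd: "bdd_above ((\<lambda>x. lp_norm p (T x)) ` ?U)"
    using C by (intro bdd_aboveI[of _ C]) fastforce
  show "lp_norm p (T x) \<le> lp_opnorm p T * lp_norm p x"
    if x: "x \<in> lp_space p" and pos: "0 < lp_norm p x" for x
  proof -
    define c where "c = (of_real (inverse (lp_norm p x)) :: 'a)"
    have norm_c: "norm c = inverse (lp_norm p x)"
      using pos by (simp add: c_def norm_inverse)
    have "(\<lambda>n. c * x n) \<in> ?U"
      using lp_space_scale[OF x] lp_norm_scale[OF x p, of c] pos norm_c by simp
    then have "lp_norm p (T (\<lambda>n. c * x n)) \<le> lp_opnorm p T"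
      unfolding lp_opnorm_def by (rule cSUP_upper[OF _ bdd])
    moreover have "T (\<lambda>n. c * x n) = (\<lambda>n. c * T x n)" "T x \<in> lp_space p"
      using T x unfolding lp_bounded_linear_def by blast+
    ultimately show ?thesis
      using lp_norm_scale[OF \<open>T x \<in> lp_space p\<close> p, of c] pos by (simp add: norm_c field_simps)
  qed
  have "?U \<noteq> {}"
  proof -
    \<comment> \<open>The first unit vector lies on the sphere.\<close>
    define e where "e n = (if n = 0 then 1 else 0 :: 'a)" for n :: nat
    have "(\<lambda>n. norm (e n) powr p) = (\<lambda>n. if n = 0 then 1 else 0)"
      by (auto simp: e_def)
    then have "(\<lambda>n. norm (e n) powr p) sums 1"
      using sums_single[of 0 "\<lambda>_. 1 :: real"] by simp
    then have "e \<in> ?U"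
      by (auto simp: lp_space_def lp_norm_def sums_iff)
    then show ?thesis
      by blast
  qed
  then show "lp_opnorm p T \<le> C"
    if "\<And>x. x \<in> lp_space p \<Longrightarrow> lp_norm p (T x) \<le> C * lp_norm p x" for C
    unfolding lp_opnorm_def by (rule cSUP_least) (use that in fastforce)
qed

section \<open>The Hilbert matrix as an operator and its norm\<close>

context
  fixes p q :: real
  assumes p: "1 < p" and q: "1 < q" and pq: "1 / p + 1 / q = 1"
begin

text \<open>Since the entries are positive, the image of \<open>x\<close> is dominated in norm by
  the image of the sequence of norms, so the real nonnegative case applies.\<close>

lemma
  fixes x :: "nat \<Rightarrow> 'a::{real_normed_field,banach}"
  assumes x: "x \<in> lp_space p"
  shows summable_norm_hilbert_row: "summable (\<lambda>n. norm (of_real (hilbert_matrix m n) * x n))"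
    and hilbert_matrix_map_in_lp: "matrix_map hilbert_matrix x \<in> lp_space p"
    and lp_norm_hilbert_matrix_map_le:
      "lp_norm p (matrix_map hilbert_matrix x) \<le> pi * csc (pi / p) * lp_norm p x"
proof -
  let ?y = "\<lambda>n. norm (x n)"
  let ?u = "\<lambda>m. \<Sum>n. hilbert_matrix m n * ?y n"
  have y: "summable (\<lambda>n. ?y n powr p)"
    using x by (simp add: lp_space_def)
  note y' = p q pq norm_ge_zero y
  have norm_eq: "norm (of_real (hilbert_matrix m n) * x n) = hilbert_matrix m n * ?y n" for m n
    by (simp add: norm_mult hilbert_matrix_pos less_imp_le)
  show row: "summable (\<lambda>n. norm (of_real (hilbert_matrix m n) * x n))" for m
    unfolding norm_eq by (rule summable_hilbert_matrix_row[OF y'])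
  have le: "norm (matrix_map hilbert_matrix x m) powr p \<le> ?u m powr p" for m
    using summable_norm[OF row, of m] p unfolding matrix_map_def norm_eq
    by (intro powr_mono2) auto
  show in_lp: "matrix_map hilbert_matrix x \<in> lp_space p"
    unfolding lp_space_def mem_Collect_eq
    by (rule summable_comparison_test'[OF summable_hilbert_matrix_map[OF y'], of 0]) (simp add: le)
  have "(\<Sum>m. norm (matrix_map hilbert_matrix x m) powr p) \<le> (\<Sum>m. ?u m powr p)"
    using in_lp by (intro suminf_le le summable_hilbert_matrix_map[OF y']) (simp add: lp_space_def)
  also have "\<dots> \<le> (pi * csc (pi / p)) powr p * (\<Sum>n. ?y n powr p)"
    by (rule suminf_hilbert_matrix_map_le[OF y'])
  also have "\<dots> = (pi * csc (pi / p) * lp_norm p x) powr p"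
    using suminf_eq_lp_norm_powr[OF x] p lp_norm_nonneg[of p x] csc_pi_div_pos[OF p]
    by (simp add: powr_mult)
  finally show "lp_norm p (matrix_map hilbert_matrix x) \<le> pi * csc (pi / p) * lp_norm p x"
    using p lp_norm_nonneg[of p x] csc_pi_div_pos[OF p] by (subst lp_norm_le_iff[OF in_lp]) auto
qed

lemma lp_bounded_linear_hilbert_matrix:
  "lp_bounded_linear p (matrix_map hilbert_matrix :: (nat \<Rightarrow> 'a::{real_normed_field,banach}) \<Rightarrow> _)"
proof -
  note row = summable_norm_hilbert_row[THEN summable_norm_cancel]
  show ?thesis
    unfolding lp_bounded_linear_def
  proof (intro conjI ballI allI exI)
    fix x y :: "nat \<Rightarrow> 'a" assume x: "x \<in> lp_space p" and y: "y \<in> lp_space p"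
    show "matrix_map hilbert_matrix (\<lambda>n. x n + y n)
        = (\<lambda>m. matrix_map hilbert_matrix x m + matrix_map hilbert_matrix y m)"
      by (simp add: matrix_map_def distrib_left suminf_add[OF row[OF x] row[OF y]])
  next
    fix c and x :: "nat \<Rightarrow> 'a" assume x: "x \<in> lp_space p"
    show "matrix_map hilbert_matrix (\<lambda>n. c * x n) = (\<lambda>m. c * matrix_map hilbert_matrix x m)"
      by (simp add: matrix_map_def mult.left_commute[of _ c] suminf_mult[OF row[OF x]])
  qed (fact hilbert_matrix_map_in_lp lp_norm_hilbert_matrix_map_le)+
qed

text \<open>
  The exponents are exchanged, \<open>q\<close> for \<open>p\<close>, so that the inner sum of the Witten series is the image
  of an \<open>\<ell>\<^sup>p\<close> sequence, and the order of summation need not be changed.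
\<close>

lemma witten_div_zeta_le_opnorm:
  fixes a :: real
  defines "T \<equiv> matrix_map hilbert_matrix :: (nat \<Rightarrow> 'a::{real_normed_field,banach}) \<Rightarrow> (nat \<Rightarrow> 'a)"
  assumes a: "1 / q < a"
  shows "witten a ((q - 1) * a) 1 / zeta (q * a) \<le> lp_opnorm p T"
proof -
  define s where "s = (q - 1) * a"
  define x where "x n = real (Suc n) powr (- s)" for n
  define u where "u n = (\<Sum>m. hilbert_matrix n m * x m)" for n
  \<comment> \<open>Conjugacy gives \<open>(q - 1) * p = q\<close>. Hence \<open>x n powr p\<close>
    and \<open>y n powr q\<close> coincide, and both power sums equal
    \<open>zeta (q * a)\<close>.\<close>
  have exps: "s * p = q * a" "1 < q * a"
    using p q pq a by (simp_all add: s_def field_simps)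
  have a_pos: "0 < a"
    using a q by (smt (verit) divide_pos_pos)
  note zeta_pos = zeta_pos[OF exps(2)]
  have x_powr: "x n powr p = real (Suc n) powr (- (q * a))" for n
    by (simp add: x_def powr_powr exps del: of_nat_Suc)
  have x_abs: "norm (of_real (x n) :: 'a) = x n" for n
    by (simp add: x_def)
  have x_lp: "(\<lambda>n. of_real (x n) :: 'a) \<in> lp_space p"
    using summable_Suc_powr[OF exps(2)] by (simp only: lp_space_def x_abs x_powr mem_Collect_eq)
  have x_norm: "lp_norm p (\<lambda>n. of_real (x n) :: 'a) = zeta (q * a) powr (1 / p)"
    by (simp only: lp_norm_def x_abs x_powr zeta_def)
  have x_nonneg: "0 \<le> x n" for n
    by (simp add: x_def)
  have x_summable: "summable (\<lambda>n. x n powr p)"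
    unfolding x_powr by (rule summable_Suc_powr[OF exps(2)])
  note row = summable_hilbert_matrix_row[OF p q pq x_nonneg x_summable]
  have u_nonneg: "0 \<le> u n" for n
    unfolding u_def by (intro suminf_nonneg row) (simp add: x_nonneg hilbert_matrix_pos less_imp_le)
  have Tx: "T (\<lambda>n. of_real (x n)) = (\<lambda>n. of_real (u n))"
    unfolding T_def matrix_map_def u_def of_real_mult[symmetric]
    by (simp add: suminf_of_real[OF row])
  have Tx_norm: "lp_norm p (T (\<lambda>n. of_real (x n))) = (\<Sum>n. u n powr p) powr (1 / p)"
    unfolding Tx using u_nonneg by (simp add: lp_norm_def)
  have u_summable: "summable (\<lambda>n. u n powr p)"
    unfolding u_def by (rule summable_hilbert_matrix_map[OF p q pq x_nonneg x_summable])
  define y where "y n = real (Suc n) powr (- a)" for n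
  have y_powr: "y n powr q = real (Suc n) powr (- (q * a))" for n
    by (simp add: y_def powr_powr mult.commute del: of_nat_Suc)
  have "witten a s 1 = (\<Sum>n. u n * y n)"
    unfolding witten_def
  proof (rule arg_cong[where f = suminf], rule ext)
    fix n
    have "(\<Sum>m. witten_term a s 1 n m) = (\<Sum>m. y n * (hilbert_matrix n m * x m))"
      by (simp add: witten_term_1 y_def x_def hilbert_matrix_def del: of_nat_Suc)
    also have "\<dots> = u n * y n"
      unfolding u_def by (subst suminf_mult[OF row]) (rule mult.commute)
    finally show "(\<Sum>m. witten_term a s 1 n m) = u n * y n" .
  qed
  also have "\<dots> \<le> (\<Sum>n. u n powr p) powr (1 / p) * (\<Sum>n. y n powr q) powr (1 / q)"
    by (rule suminf_Holder[OF p q pq u_nonneg _ u_summable])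
       (unfold y_powr, simp add: y_def, rule summable_Suc_powr[OF exps(2)])
  also have "\<dots> = lp_norm p (T (\<lambda>n. of_real (x n))) * zeta (q * a) powr (1 / q)"
    unfolding Tx_norm y_powr zeta_def ..
  also have "\<dots> \<le> lp_opnorm p T * zeta (q * a) powr (1 / p) * zeta (q * a) powr (1 / q)"
    using lp_norm_le_opnorm[OF lp_bounded_linear_hilbert_matrix _ x_lp] p zeta_pos
    by (intro mult_right_mono) (auto simp: T_def x_norm)
  \<comment> \<open>The two powers of \<open>zeta (q * a)\<close> combine because their exponents
    add up to 1.\<close>
  also have "\<dots> = lp_opnorm p T * zeta (q * a)"
    using zeta_pos by (simp add: mult.assoc powr_add[symmetric] pq)
  finally show ?thesis
    using zeta_pos by (simp add: s_def pos_divide_le_eq)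
qed

text \<open>The Schur bound is the upper estimate. For the lower one, the quotients with
  \<open>p\<close> and \<open>q\<close> exchanged stay below the norm and tend to
  \<open>pi * csc (pi / q)\<close>, which equals \<open>pi * csc (pi / p)\<close>.\<close>

lemma lp_opnorm_hilbert_matrix:
  "lp_opnorm p (matrix_map hilbert_matrix :: (nat \<Rightarrow> 'a::{real_normed_field,banach}) \<Rightarrow> (nat \<Rightarrow> 'a))
    = pi * csc (pi / p)"
proof (rule antisym)
  let ?T = "matrix_map hilbert_matrix :: (nat \<Rightarrow> 'a) \<Rightarrow> (nat \<Rightarrow> 'a)"
  show "lp_opnorm p ?T \<le> pi * csc (pi / p)"
    by (rule lp_opnorm_le[OF lp_bounded_linear_hilbert_matrix])
       (use p in \<open>auto intro: lp_norm_hilbert_matrix_map_le\<close>)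
  have "1 / q + 1 / p = 1"
    using pq by simp
  from witten_div_zeta_tendsto[OF q p this] have "pi * csc (pi / q) \<le> lp_opnorm p ?T"
  proof (rule tendsto_upperbound)
    have "\<forall>\<^sub>F a in at_right (1 / q). 1 / q < a"
      by (simp add: eventually_at_right_less)
    then show "\<forall>\<^sub>F a in at_right (1 / q). witten a ((q - 1) * a) 1 / zeta (q * a) \<le> lp_opnorm p ?T"
      by eventually_elim (rule witten_div_zeta_le_opnorm)
  qed simp
  then show "pi * csc (pi / p) \<le> lp_opnorm p ?T"
    using sin_pi_conjugate[OF pq] by (simp add: csc_def)
qed

end

theorem theorem6:
  fixes p q :: real
  assumes "1 < p" and "1 < q" and "1 / p + 1 / q = 1"
  shows "(\<forall>x \<in> (lp_space p :: (nat \<Rightarrow> 'a::{real_normed_field,banach}) set).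
            \<forall>m. summable (\<lambda>n. of_real (hilbert_matrix m n) * x n)) \<and>
         lp_bounded_linear p (matrix_map hilbert_matrix :: (nat \<Rightarrow> 'a) \<Rightarrow> (nat \<Rightarrow> 'a)) \<and>
         (\<forall>s > 1 / p. witten_converges s ((p - 1) * s) 1) \<and>
         ((\<lambda>s. witten s ((p - 1) * s) 1 / zeta (p * s))
            \<longlongrightarrow> lp_opnorm p (matrix_map hilbert_matrix :: (nat \<Rightarrow> 'a) \<Rightarrow> (nat \<Rightarrow> 'a)))
           (at_right (1 / p)) \<and>
         lp_opnorm p (matrix_map hilbert_matrix :: (nat \<Rightarrow> 'a) \<Rightarrow> (nat \<Rightarrow> 'a)) = pi * csc (pi / p)"
proof (intro conjI ballI allI impI)
  fix x :: "nat \<Rightarrow> 'a" and m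
  assume "x \<in> lp_space p"
  then show "summable (\<lambda>n. of_real (hilbert_matrix m n) * x n)"
    by (rule summable_norm_hilbert_row[OF assms, THEN summable_norm_cancel])
next
  fix s :: real
  assume s: "1 / p < s"
  have "0 < s"
    using s assms(1) by (smt (verit) divide_pos_pos)
  moreover have "1 < s + (p - 1) * s"
    using s assms(1) by (simp add: field_simps)
  ultimately show "witten_converges s ((p - 1) * s) 1"
    using assms(1) by (intro witten_converges_1) auto
qed (simp_all add: lp_bounded_linear_hilbert_matrix[OF assms] lp_opnorm_hilbert_matrix[OF assms]
  witten_div_zeta_tendsto[OF assms])

end
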